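(* Let $(L;\wedge,\vee,^{\Delta},^{\nabla},0,1)$ be a weakly dicomplemented lattice. For $a\in L$ let $S[a)$ be the smallest S-filter of $L$ containing $a$, and let $SF_p(L)=\{S[a)\mid a\in L\}$. Define $S[a)^{\perp}=S[a^{\Delta})$. Then $SF_p(L)$, with the operations $\cap$ (intersection) and $\underline{\vee}$ (the join in the lattice of S-filters of $L$ ordered by inclusion), the unary operation $^{\perp}$, and constants $S[1)=\{1\}$ and $S[0)=L$, is an ortholattice, and it is isomorphic (as an ortholattice) to $(\overline{S}(L);\overline{\sqcap},\vee,^{\Delta},0,1)$.
   Context: A weakly dicomplemented lattice (WDL) is an algebra $(L;\wedge,\vee,^{\Delta},^{\nabla},0,1)$ such that $(L;\wedge,\vee,0,1)$ is a bounded lattice and, for all $x,y\in L$: $x^{\Delta\Delta}\le x$; $x\le y\Rightarrow y^{\Delta}\le x^{\Delta}$; $(x\wedge y)\vee(x\wedge y^{\Delta})=x$; $x^{\nabla\nabla}\ge x$; $x\le y\Rightarrow y^{\nabla}\le x^{\nabla}$; $(x\vee y)\wedge(x\vee y^{\nabla})=x$. A filter of $L$ is a nonempty upward closed subset closed under $\wedge$. $\overline{S}(L)=\{x\in L\mid x^{\Delta\Delta}=x\}$ and $x\,\overline{\sqcap}\,y=(x^{\Delta}\vee y^{\Delta})^{\Delta}$. An S-filter of $L$ is a filter $F$ of $L$ with $x\,\overline{\sqcap}\,y\in F$ whenever $x,y\in F$. An ortholattice is a bounded lattice with an order-reversing involution $^{\perp}$ with $a\vee a^{\perp}=1$ and $a\wedge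 a^{\perp}=0$. *)

theory Defs
  imports Main
begin

locale weakly_dicomplemented_lattice =
  fixes delta nabla :: "'a::bounded_lattice \<Rightarrow> 'a"
  assumes delta_delta_le: "delta (delta x) \<le> x"
    and delta_antimono: "x \<le> y \<Longrightarrow> delta y \<le> delta x"
    and delta_split: "sup (inf x y) (inf x (delta y)) = x"
    and nabla_nabla_ge: "x \<le> nabla (nabla x)"
    and nabla_antimono: "x \<le> y \<Longrightarrow> nabla y \<le> nabla x"
    and nabla_split: "inf (sup x y) (sup x (nabla y)) = x"

definition lattice_filter :: "'a::lattice set \<Rightarrow> bool" where
  "lattice_filter F \<longleftrightarrow> F \<noteq> {} \<and> (\<forall>x\<in>F. \<forall>y. x \<le> y \<longrightarrow> y \<in> F) \<and> (\<forall>x\<in>F. \<forall>y\<in>F. inf x y \<in> F)"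

definition skeleton :: "('a \<Rightarrow> 'a) \<Rightarrow> 'a set" where
  "skeleton delta = {x. delta (delta x) = x}"

definition skeleton_meet :: "('a::lattice \<Rightarrow> 'a) \<Rightarrow> 'a \<Rightarrow> 'a \<Rightarrow> 'a" where
  "skeleton_meet delta x y = delta (sup (delta x) (delta y))"

definition S_filter :: "('a::lattice \<Rightarrow> 'a) \<Rightarrow> 'a set \<Rightarrow> bool" where
  "S_filter delta F \<longleftrightarrow> lattice_filter F \<and> (\<forall>x\<in>F. \<forall>y\<in>F. skeleton_meet delta x y \<in> F)"

text \<open>\<open>LEAST\<close> on sets refers to inclusion. The least sets in the next two definitions always
  exist; see \<open>S_filter_generated_is_least\<close> and \<open>S_filter_join_is_least\<close> below.\<close>

definition S_filter_generated :: "('a::lattice \<Rightarrow> 'a) \<Rightarrow> 'a \<Rightarrow> 'a set" where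
  "S_filter_generated delta a = (LEAST F. S_filter delta F \<and> a \<in> F)"

definition S_filter_join :: "('a::lattice \<Rightarrow> 'a) \<Rightarrow> 'a set \<Rightarrow> 'a set \<Rightarrow> 'a set" where
  "S_filter_join delta F G = (LEAST H. S_filter delta H \<and> F \<subseteq> H \<and> G \<subseteq> H)"

definition principal_S_filters :: "('a::lattice \<Rightarrow> 'a) \<Rightarrow> 'a set set" where
  "principal_S_filters delta = range (S_filter_generated delta)"

text \<open>The prescription \<open>S[a)\<^sup>\<bottom> = S[a\<^sup>\<Delta>)\<close> refers to a generator \<open>a\<close>. The definite description below
  is meaningful only if the result does not depend on the choice of that generator.\<close>

definition S_filter_perp :: "('a::lattice \<Rightarrow> 'a) \<Rightarrow> 'a set \<Rightarrow> 'a set" where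
  "S_filter_perp delta F =
     (THE G. \<exists>a. F = S_filter_generated delta a \<and> G = S_filter_generated delta (delta a))"

record 'a ortho_algebra =
  ol_carrier :: "'a set"
  ol_meet :: "'a \<Rightarrow> 'a \<Rightarrow> 'a"
  ol_join :: "'a \<Rightarrow> 'a \<Rightarrow> 'a"
  ol_perp :: "'a \<Rightarrow> 'a"
  ol_zero :: "'a"
  ol_one :: "'a"

definition bounded_lattice_on ::
    "'a set \<Rightarrow> ('a \<Rightarrow> 'a \<Rightarrow> 'a) \<Rightarrow> ('a \<Rightarrow> 'a \<Rightarrow> 'a) \<Rightarrow> 'a \<Rightarrow> 'a \<Rightarrow> bool" where
  "bounded_lattice_on A meet join z e \<longleftrightarrow>
     z \<in> A \<and> e \<in> A \<and>
     (\<forall>x\<in>A. \<forall>y\<in>A. meet x y \<in> A \<and> join x y \<in> A) \<and>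
     (\<forall>x\<in>A. \<forall>y\<in>A. meet x y = meet y x \<and> join x y = join y x) \<and>
     (\<forall>x\<in>A. \<forall>y\<in>A. \<forall>w\<in>A. meet (meet x y) w = meet x (meet y w) \<and>
                            join (join x y) w = join x (join y w)) \<and>
     (\<forall>x\<in>A. \<forall>y\<in>A. meet x (join x y) = x \<and> join x (meet x y) = x) \<and>
     (\<forall>x\<in>A. meet z x = z \<and> join x e = e)"

definition ortholattice :: "'a ortho_algebra \<Rightarrow> bool" where
  "ortholattice A \<longleftrightarrow>
     bounded_lattice_on (ol_carrier A) (ol_meet A) (ol_join A) (ol_zero A) (ol_one A) \<and>
     (\<forall>x\<in>ol_carrier A. ol_perp A x \<in> ol_carrier A \<and> ol_perp A (ol_perp A x) = x) \<and>
     (\<forall>x\<in>ol_carrier A. \<forall>y\<in>ol_carrier A.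
        ol_meet A x y = x \<longrightarrow> ol_meet A (ol_perp A y) (ol_perp A x) = ol_perp A y) \<and>
     (\<forall>x\<in>ol_carrier A. ol_join A x (ol_perp A x) = ol_one A \<and>
                        ol_meet A x (ol_perp A x) = ol_zero A)"

definition ortho_isomorphism :: "'a ortho_algebra \<Rightarrow> 'b ortho_algebra \<Rightarrow> ('a \<Rightarrow> 'b) \<Rightarrow> bool" where
  "ortho_isomorphism A B f \<longleftrightarrow>
     bij_betw f (ol_carrier A) (ol_carrier B) \<and>
     (\<forall>x\<in>ol_carrier A. \<forall>y\<in>ol_carrier A.
        f (ol_meet A x y) = ol_meet B (f x) (f y) \<and>
        f (ol_join A x y) = ol_join B (f x) (f y)) \<and>
     (\<forall>x\<in>ol_carrier A. f (ol_perp A x) = ol_perp B (f x)) \<and>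
     f (ol_zero A) = ol_zero B \<and> f (ol_one A) = ol_one B"

definition ortho_isomorphic :: "'a ortho_algebra \<Rightarrow> 'b ortho_algebra \<Rightarrow> bool" where
  "ortho_isomorphic A B \<longleftrightarrow> (\<exists>f. ortho_isomorphism A B f)"

text \<open>Inclusion is reversed by \<open>a \<mapsto> S[a)\<close>, so the least element of this algebra is \<open>S[1)\<close>
  and the greatest is \<open>S[0)\<close>.\<close>

definition principal_S_filter_algebra ::
    "('a::bounded_lattice \<Rightarrow> 'a) \<Rightarrow> 'a set ortho_algebra" where
  "principal_S_filter_algebra delta =
     \<lparr>ol_carrier = principal_S_filters delta,
      ol_meet = (\<inter>),
      ol_join = S_filter_join delta,
      ol_perp = S_filter_perp delta,
      ol_zero = S_filter_generated delta top,
      ol_one = S_filter_generated delta bot\<rparr>"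

definition skeleton_algebra :: "('a::bounded_lattice \<Rightarrow> 'a) \<Rightarrow> 'a ortho_algebra" where
  "skeleton_algebra delta =
     \<lparr>ol_carrier = skeleton delta,
      ol_meet = skeleton_meet delta,
      ol_join = sup,
      ol_perp = delta,
      ol_zero = bot,
      ol_one = top\<rparr>"

lemma bounded_lattice_on_UNIV:
  "bounded_lattice_on (UNIV :: 'a::bounded_lattice set) inf sup bot top"
  unfolding bounded_lattice_on_def
  by (intro conjI ballI) (simp_all add: ac_simps)

lemma S_filter_Inter:
  fixes delta :: "'a::bounded_lattice \<Rightarrow> 'a"
  assumes "\<And>F. F \<in> C \<Longrightarrow> S_filter delta F"
  shows "S_filter delta (\<Inter>C)"
proof -
  have "top \<in> F" if "F \<in> C" for F
    using assms[OF that] by (auto simp: S_filter_def lattice_filter_def)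
  then have "top \<in> \<Inter>C"
    by blast
  then have "\<Inter>C \<noteq> {}"
    by blast
  moreover have "y \<in> \<Inter>C" if "x \<in> \<Inter>C" "x \<le> y" for x y
    using assms that by (simp add: S_filter_def lattice_filter_def) metis
  moreover have "inf x y \<in> \<Inter>C" "skeleton_meet delta x y \<in> \<Inter>C"
    if "x \<in> \<Inter>C" "y \<in> \<Inter>C" for x y
    using assms that by (simp_all add: S_filter_def lattice_filter_def)
  ultimately show ?thesis
    unfolding S_filter_def lattice_filter_def by simp
qed

lemma S_filter_generated_is_least:
  fixes delta :: "'a::bounded_lattice \<Rightarrow> 'a"
  shows "S_filter delta (S_filter_generated delta a)"
    and "a \<in> S_filter_generated delta a"
    and "S_filter delta F \<Longrightarrow> a \<in> F \<Longrightarrow> S_filter_generated delta a \<subseteq> F"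
proof -
  let ?M = "\<Inter>{F. S_filter delta F \<and> a \<in> F}"
  have "S_filter_generated delta a = ?M"
    unfolding S_filter_generated_def
    by (rule Least_equality) (auto intro: S_filter_Inter)
  then show "S_filter delta (S_filter_generated delta a)"
    and "a \<in> S_filter_generated delta a"
    and "S_filter delta F \<Longrightarrow> a \<in> F \<Longrightarrow> S_filter_generated delta a \<subseteq> F"
    by (auto intro: S_filter_Inter)
qed

lemma S_filter_join_is_least:
  fixes delta :: "'a::bounded_lattice \<Rightarrow> 'a"
  shows "S_filter delta (S_filter_join delta F G)"
    and "F \<subseteq> S_filter_join delta F G"
    and "G \<subseteq> S_filter_join delta F G"
    and "S_filter delta H \<Longrightarrow> F \<subseteq> H \<Longrightarrow> G \<subseteq> H \<Longrightarrow> S_filter_join delta F G \<subseteq> H"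
proof -
  let ?M = "\<Inter>{H. S_filter delta H \<and> F \<subseteq> H \<and> G \<subseteq> H}"
  have "S_filter_join delta F G = ?M"
    unfolding S_filter_join_def
    by (rule Least_equality) (auto intro: S_filter_Inter)
  then show "S_filter delta (S_filter_join delta F G)"
    and "F \<subseteq> S_filter_join delta F G"
    and "G \<subseteq> S_filter_join delta F G"
    and "S_filter delta H \<Longrightarrow> F \<subseteq> H \<Longrightarrow> G \<subseteq> H \<Longrightarrow> S_filter_join delta F G \<subseteq> H"
    by (auto intro: S_filter_Inter)
qed

end

theory Submission
  imports Defs
begin

text \<open>Since the skeleton meet of \<open>a\<close> with itself is \<open>a\<^sup>\<Delta>\<^sup>\<Delta>\<close>, \<open>S[a)\<close> is the principal up-set of \<open>a\<^sup>\<Delta>\<^sup>\<Delta>\<close>. Hence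
  \<open>x \<mapsto> S[x\<^sup>\<Delta>)\<close>, the up-set of \<open>x\<^sup>\<Delta>\<close>, is a bijection from the skeleton to the principal
  S-filters; composing with \<open>\<^sup>\<Delta>\<close> compensates for the order reversal of \<open>a \<mapsto> S[a)\<close>, so it preserves
  all operations and carries the ortholattice structure of the skeleton over.\<close>

text \<open>The explicit map runs from the skeleton to the filters, whereas the theorem asks for the
  opposite direction. Closure of \<open>A\<close> under its operations keeps all values in the
  domain where \<open>f\<close> is injective.\<close>

lemma ortho_isomorphism_inv_into:
  assumes A: "ortholattice A" and f: "ortho_isomorphism A B f"
  shows "ortho_isomorphism B A (inv_into (ol_carrier A) f)"
proof -
  let ?g = "inv_into (ol_carrier A) f"
  have bij: "bij_betw f (ol_carrier A) (ol_carrier B)"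
    using f by (simp add: ortho_isomorphism_def)
  have g_in: "?g u \<in> ol_carrier A" and fg: "f (?g u) = u" if "u \<in> ol_carrier B" for u
    using bij that by (auto simp: bij_betw_def inv_into_into f_inv_into_f)
  have gf: "?g (f x) = x" if "x \<in> ol_carrier A" for x
    using bij that by (simp add: bij_betw_inv_into_left)
  \<comment> \<open>Every equation for \<open>?g\<close> is verified by applying \<open>f\<close> to
    the proposed value, which turns it into an equation known for \<open>f\<close>.\<close>
  have g_eq: "?g u = x" if "x \<in> ol_carrier A" "f x = u" for u x
    using gf that by blast
  have closed: "ol_meet A x y \<in> ol_carrier A" "ol_join A x y \<in> ol_carrier A"
    if "x \<in> ol_carrier A" "y \<in> ol_carrier A" for x y
    using A that by (auto simp: ortholattice_def bounded_lattice_on_def)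
  have perp_closed: "ol_perp A x \<in> ol_carrier A" if "x \<in> ol_carrier A" for x
    using A that by (simp add: ortholattice_def)
  have constants: "ol_zero A \<in> ol_carrier A" "ol_one A \<in> ol_carrier A"
    using A by (auto simp: ortholattice_def bounded_lattice_on_def)
  show ?thesis
    unfolding ortho_isomorphism_def
  proof (intro conjI ballI)
    show "bij_betw ?g (ol_carrier B) (ol_carrier A)"
      using bij by (rule bij_betw_inv_into)
  next
    fix u v assume uv: "u \<in> ol_carrier B" "v \<in> ol_carrier B"
    show "?g (ol_meet B u v) = ol_meet A (?g u) (?g v)"
      using f uv by (intro g_eq) (simp_all add: ortho_isomorphism_def closed g_in fg)
    show "?g (ol_join B u v) = ol_join A (?g u) (?g v)"
      using f uv by (intro g_eq) (simp_all add: ortho_isomorphism_def closed g_in fg)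
  next
    fix u assume u: "u \<in> ol_carrier B"
    show "?g (ol_perp B u) = ol_perp A (?g u)"
      using f u by (intro g_eq) (simp_all add: ortho_isomorphism_def perp_closed g_in fg)
  next
    show "?g (ol_zero B) = ol_zero A" "?g (ol_one B) = ol_one A"
      using f constants by (auto intro!: g_eq simp: ortho_isomorphism_def)
  qed
qed

text \<open>All elements of \<open>B\<close> have the form \<open>f x\<close> and its operations are
  images of those of \<open>A\<close>, so the laws are inherited. This avoids computing with joins
  of S-filters.\<close>

lemma ortholattice_isomorphic_image:
  assumes A: "ortholattice A" and f: "ortho_isomorphism A B f"
  shows "ortholattice B"
proof -
  have carrier: "ol_carrier B = f ` ol_carrier A" and inj: "inj_on f (ol_carrier A)"
    using f by (auto simp: ortho_isomorphism_def bij_betw_def)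
  have meet: "ol_meet B (f x) (f y) = f (ol_meet A x y)"
    and join: "ol_join B (f x) (f y) = f (ol_join A x y)"
    if "x \<in> ol_carrier A" "y \<in> ol_carrier A" for x y
    using f that by (simp_all add: ortho_isomorphism_def)
  have perp: "ol_perp B (f x) = f (ol_perp A x)" if "x \<in> ol_carrier A" for x
    using f that by (simp add: ortho_isomorphism_def)
  have constants: "ol_zero B = f (ol_zero A)" "ol_one B = f (ol_one A)"
    using f by (simp_all add: ortho_isomorphism_def)
  have closed: "ol_meet A x y \<in> ol_carrier A" "ol_join A x y \<in> ol_carrier A"
    if "x \<in> ol_carrier A" "y \<in> ol_carrier A" for x y
    using A that by (auto simp: ortholattice_def bounded_lattice_on_def)
  have perp_closed: "ol_perp A x \<in> ol_carrier A" if "x \<in> ol_carrier A" for x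
    using A that by (simp add: ortholattice_def)
  have lat: "bounded_lattice_on (ol_carrier A) (ol_meet A) (ol_join A) (ol_zero A) (ol_one A)"
    using A by (simp add: ortholattice_def)
  have constants_closed: "ol_zero A \<in> ol_carrier A" "ol_one A \<in> ol_carrier A"
    using lat by (simp_all add: bounded_lattice_on_def)
  have "bounded_lattice_on (ol_carrier B) (ol_meet B) (ol_join B) (ol_zero B) (ol_one B)"
    unfolding bounded_lattice_on_def carrier constants
    by (simp add: meet join closed constants_closed)
      (use lat[unfolded bounded_lattice_on_def] in
        \<open>intro conjI ballI arg_cong[of _ _ f]; blast\<close>)
  \<comment> \<open>Order reversal is conditional: injectivity of \<open>f\<close> is needed to pull
    its premise back to \<open>A\<close>.\<close>
  moreover have "\<forall>x\<in>ol_carrier A. \<forall>y\<in>ol_carrier A.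
      f (ol_meet A x y) = f x \<longrightarrow> f (ol_meet A (ol_perp A y) (ol_perp A x)) = f (ol_perp A y)"
    using A inj by (auto simp: ortholattice_def inj_on_eq_iff closed perp_closed)
  ultimately show ?thesis
    using A unfolding ortholattice_def carrier constants
    by (simp add: meet join perp closed perp_closed)
qed

context weakly_dicomplemented_lattice
begin

lemma delta_delta_delta: "delta (delta (delta x)) = delta x"
  by (meson antisym delta_antimono delta_delta_le)

lemma sup_delta: "sup x (delta x) = top"
  using delta_split[of top x] by simp

lemma delta_bot: "delta bot = top"
  using sup_delta[of bot] by simp

lemma delta_top: "delta top = bot"
  using delta_delta_le[of bot] by (simp add: delta_bot bot_unique)

lemma delta_in_skeleton: "delta x \<in> skeleton delta"
  by (simp add: skeleton_def delta_delta_delta)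

text \<open>The map \<open>delta \<circ> delta\<close> is monotone and lies below the identity, so
  its fixed points are closed under joins.\<close>

lemma sup_in_skeleton:
  assumes "x \<in> skeleton delta" "y \<in> skeleton delta"
  shows "sup x y \<in> skeleton delta"
proof -
  have "x \<le> delta (delta (sup x y))" "y \<le> delta (delta (sup x y))"
    using assms delta_antimono[OF delta_antimono[OF sup_ge1], of x y]
      delta_antimono[OF delta_antimono[OF sup_ge2], of y x]
    by (simp_all add: skeleton_def)
  then show ?thesis
    by (simp add: skeleton_def antisym delta_delta_le)
qed

lemma delta_eq_iff:
  assumes "x \<in> skeleton delta" "y \<in> skeleton delta"
  shows "delta x = delta y \<longleftrightarrow> x = y"
proof
  assume "delta x = delta y"
  then have "delta (delta x) = delta (delta y)"
    by (rule arg_cong)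
  then show "x = y"
    using assms by (simp add: skeleton_def)
qed (rule arg_cong)

text \<open>A De Morgan law: the right-hand side is itself a skeleton element, so the double
  \<open>delta\<close> in front of it disappears.\<close>

lemma delta_skeleton_meet:
  assumes "x \<in> skeleton delta" "y \<in> skeleton delta"
  shows "delta (skeleton_meet delta x y) = sup (delta x) (delta y)"
  using sup_in_skeleton[OF delta_in_skeleton delta_in_skeleton, of x y]
  by (simp add: skeleton_meet_def skeleton_def)

text \<open>Links the equational order used in \<open>ortholattice\<close> to \<le>. On the skeleton
  \<open>delta\<close> is injective and reverses the order in both directions, so the claim becomes
  one about joins.\<close>

lemma skeleton_meet_eq_left_iff:
  assumes "x \<in> skeleton delta" "y \<in> skeleton delta"
  shows "skeleton_meet delta x y = x \<longleftrightarrow> x \<le> y"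
proof -
  have "skeleton_meet delta x y = x \<longleftrightarrow> delta y \<le> delta x"
    using assms delta_skeleton_meet[OF assms]
      delta_eq_iff[of "skeleton_meet delta x y" x] delta_in_skeleton
    by (simp add: skeleton_meet_def le_iff_sup sup.commute)
  also have "\<dots> \<longleftrightarrow> x \<le> y"
    using assms delta_antimono[of x y] delta_antimono[of "delta y" "delta x"]
    by (auto simp: skeleton_def)
  finally show ?thesis .
qed

lemma ortholattice_skeleton_algebra: "ortholattice (skeleton_algebra delta)"
proof -
  have meet_in: "skeleton_meet delta x y \<in> skeleton delta" for x y
    by (simp add: skeleton_meet_def delta_in_skeleton)
  have dd: "delta (delta x) = x" if "x \<in> skeleton delta" for x
    using that by (simp add: skeleton_def)
  have assoc: "skeleton_meet delta (skeleton_meet delta x y) w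
      = skeleton_meet delta x (skeleton_meet delta y w)"
    if "x \<in> skeleton delta" "y \<in> skeleton delta" "w \<in> skeleton delta" for x y w
    \<comment> \<open>Unfolding just the outer meets leaves the inner ones to the De Morgan law;
      associativity of \<open>sup\<close> remains.\<close>
    unfolding skeleton_meet_def[of _ "skeleton_meet delta x y"]
      skeleton_meet_def[of _ _ "skeleton_meet delta y w"]
    using that by (simp add: delta_skeleton_meet sup.assoc)
  have absorb1: "skeleton_meet delta x (sup x y) = x"
    if "x \<in> skeleton delta" "y \<in> skeleton delta" for x y
    using that by (simp add: skeleton_meet_eq_left_iff sup_in_skeleton)
  have absorb2: "sup x (skeleton_meet delta x y) = x"
    if "x \<in> skeleton delta" "y \<in> skeleton delta" for x y
  proof -
    have "skeleton_meet delta x y \<le> x"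
      unfolding skeleton_meet_def
      using delta_antimono[OF sup_ge1, of "delta x" "delta y"] that by (simp add: dd)
    then show ?thesis by (simp add: sup_absorb1)
  qed
  have constants: "bot \<in> skeleton delta" "top \<in> skeleton delta"
    by (simp_all add: skeleton_def delta_bot delta_top)
  \<comment> \<open>The skeleton meet of \<open>x\<close> and \<open>delta x\<close> is
    \<open>bot\<close> because \<open>sup_delta\<close> reduces it to
    \<open>delta top\<close>.\<close>
  show ?thesis
    unfolding ortholattice_def bounded_lattice_on_def skeleton_algebra_def
    by (simp add: meet_in sup_in_skeleton assoc absorb1 absorb2 constants dd delta_in_skeleton
        sup_delta skeleton_meet_eq_left_iff sup.assoc)
      (auto simp: skeleton_meet_def sup.commute sup_delta delta_top delta_bot delta_antimono)
qed

text \<open>If \<open>x\<close> and \<open>y\<close> lie above \<open>s\<close>, then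
  \<open>sup (delta x) (delta y)\<close> lies below \<open>delta s\<close>; one more
  \<open>delta\<close> returns to \<open>s\<close>, since \<open>s\<close> is in the
  skeleton.\<close>

lemma S_filter_atLeast:
  assumes "s \<in> skeleton delta"
  shows "S_filter delta {s..}"
proof -
  have "s \<le> skeleton_meet delta x y" if "s \<le> x" "s \<le> y" for x y
  proof -
    have "sup (delta x) (delta y) \<le> delta s"
      using that by (simp add: delta_antimono)
    then show ?thesis
      using assms delta_antimono by (fastforce simp: skeleton_meet_def skeleton_def)
  qed
  then show ?thesis
    by (auto simp: S_filter_def lattice_filter_def)
qed

lemma S_filter_generated_eq_atLeast: "S_filter_generated delta a = {delta (delta a)..}"
proof
  show "S_filter_generated delta a \<subseteq> {delta (delta a)..}"
    using delta_delta_le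
    by (intro S_filter_generated_is_least(3) S_filter_atLeast delta_in_skeleton) simp
  have "skeleton_meet delta a a \<in> S_filter_generated delta a"
    using S_filter_generated_is_least(1,2)[where delta = delta and a = a] by (auto simp: S_filter_def)
  then show "{delta (delta a)..} \<subseteq> S_filter_generated delta a"
    using S_filter_generated_is_least(1)[of delta a]
    by (auto simp: S_filter_def lattice_filter_def skeleton_meet_def)
qed

text \<open>Independence of the generator: equal up-sets have equal least elements
  \<open>delta (delta a)\<close>, and a third \<open>delta\<close> recovers
  \<open>delta a\<close>.\<close>

lemma S_filter_perp_generated:
  "S_filter_perp delta (S_filter_generated delta a) = S_filter_generated delta (delta a)"
  unfolding S_filter_perp_def
proof (rule the_equality)
  fix G
  assume "\<exists>b. S_filter_generated delta a = S_filter_generated delta b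
            \<and> G = S_filter_generated delta (delta b)"
  then obtain b where "delta (delta a) = delta (delta b)"
      and G: "G = S_filter_generated delta (delta b)"
    by (auto simp: S_filter_generated_eq_atLeast)
  then have "delta a = delta b"
    by (metis delta_delta_delta)
  with G show "G = S_filter_generated delta (delta a)"
    by simp
qed blast

text \<open>The skeleton meet lies below \<open>s\<close> and \<open>t\<close>, so its up-set
  contains both up-sets; conversely, every S-filter containing \<open>s\<close> and \<open>t\<close>
  contains their skeleton meet.\<close>

lemma S_filter_join_atLeast:
  assumes "s \<in> skeleton delta" "t \<in> skeleton delta"
  shows "S_filter_join delta {s..} {t..} = {skeleton_meet delta s t..}"
proof
  have "skeleton_meet delta s t \<le> s" "skeleton_meet delta s t \<le> t"
    using assms delta_antimono[OF sup_ge1, of "delta s" "delta t"]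
      delta_antimono[OF sup_ge2, of "delta s" "delta t"]
    by (simp_all add: skeleton_meet_def skeleton_def)
  then show "S_filter_join delta {s..} {t..} \<subseteq> {skeleton_meet delta s t..}"
    by (intro S_filter_join_is_least(4) S_filter_atLeast)
      (auto simp: skeleton_meet_def delta_in_skeleton)
  have "skeleton_meet delta s t \<in> S_filter_join delta {s..} {t..}"
    using S_filter_join_is_least(1-3)[where delta = delta and F = "{s..}" and G = "{t..}"]
    by (auto simp: S_filter_def)
  then show "{skeleton_meet delta s t..} \<subseteq> S_filter_join delta {s..} {t..}"
    using S_filter_join_is_least(1)[of delta "{s..}" "{t..}"]
    by (auto simp: S_filter_def lattice_filter_def)
qed

lemma ortho_isomorphism_generated_delta:
  "ortho_isomorphism (skeleton_algebra delta) (principal_S_filter_algebra delta)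
     (\<lambda>x. S_filter_generated delta (delta x))"
proof -
  have gen: "S_filter_generated delta (delta x) = {delta x..}" for x
    by (simp add: S_filter_generated_eq_atLeast delta_delta_delta)
  have "inj_on (\<lambda>x. {delta x..}) (skeleton delta)"
    by (auto simp: inj_on_def delta_eq_iff)
  \<comment> \<open>The filter generated by an arbitrary \<open>a\<close> is the image of the
    skeleton element \<open>delta a\<close>.\<close>
  moreover have "(\<lambda>x. {delta x..}) ` skeleton delta = principal_S_filters delta"
    by (auto simp: principal_S_filters_def S_filter_generated_eq_atLeast image_iff
        intro: delta_in_skeleton)
      (metis delta_delta_delta)
  ultimately have "bij_betw (\<lambda>x. {delta x..}) (skeleton delta) (principal_S_filters delta)"
    by (simp add: bij_betw_def)
  moreover have "{delta (skeleton_meet delta x y)..} = {delta x..} \<inter> {delta y..}"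
    if "x \<in> skeleton delta" "y \<in> skeleton delta" for x y
    using that by (auto simp: delta_skeleton_meet)
  \<comment> \<open>The skeleton meet of \<open>delta x\<close> and \<open>delta y\<close> involves
    \<open>delta (delta x)\<close> and \<open>delta (delta y)\<close>, which are \<open>x\<close>
    and \<open>y\<close> again.\<close>
  moreover have "{delta (sup x y)..} = S_filter_join delta {delta x..} {delta y..}"
    if "x \<in> skeleton delta" "y \<in> skeleton delta" for x y
    using that by (simp add: S_filter_join_atLeast delta_in_skeleton)
      (simp add: skeleton_meet_def skeleton_def)
  moreover have "{delta (delta x)..} = S_filter_perp delta {delta x..}" for x
    using S_filter_perp_generated[of "delta x"] by (simp add: gen)
  moreover have "{delta bot..} = S_filter_generated delta top"
      "{delta top..} = S_filter_generated delta bot"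
    by (simp_all add: S_filter_generated_eq_atLeast delta_bot delta_top)
  ultimately show ?thesis
    unfolding ortho_isomorphism_def skeleton_algebra_def principal_S_filter_algebra_def gen
    by simp
qed

end

theorem theorem4p12:
  fixes delta nabla :: "'a::bounded_lattice \<Rightarrow> 'a"
  assumes "weakly_dicomplemented_lattice delta nabla"
  shows "(\<forall>a. S_filter_perp delta (S_filter_generated delta a) = S_filter_generated delta (delta a)) \<and>
         S_filter_generated delta top = {top} \<and>
         S_filter_generated delta bot = UNIV \<and>
         ortholattice (principal_S_filter_algebra delta) \<and>
         ortholattice (skeleton_algebra delta) \<and>
         ortho_isomorphic (principal_S_filter_algebra delta) (skeleton_algebra delta)"
proof -
  interpret weakly_dicomplemented_lattice delta nabla
    by (fact assms)
  have "S_filter_generated delta top = {top}" "S_filter_generated delta bot = UNIV"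
    by (auto simp: S_filter_generated_eq_atLeast delta_top delta_bot top_unique)
  then show ?thesis
    using S_filter_perp_generated ortholattice_skeleton_algebra
      ortholattice_isomorphic_image[OF ortholattice_skeleton_algebra
        ortho_isomorphism_generated_delta]
      ortho_isomorphism_inv_into[OF ortholattice_skeleton_algebra
        ortho_isomorphism_generated_delta]
    by (auto simp: ortho_isomorphic_def)
qed

end
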